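(* Let $\Gamma$ be a finite simplicial graph, let $K\subset\Gamma$ be a proper clique, and let $\Gamma'$ be the finite simplicial graph constructed from $(\Gamma,K)$ as described in the context. Then the right-angled Coxeter groups $W_\Gamma$ and $W_{\Gamma'}$ are commensurable.
   Context: Right-angled Coxeter group: for a finite simplicial graph $\Gamma$ with vertex set $V(\Gamma)$ and edge set $E(\Gamma)$, $W_\Gamma$ is the group generated by $V(\Gamma)$ with relations $v^2=1$ for all $v\in V(\Gamma)$ and $v_1v_2=v_2v_1$ whenever $(v_1,v_2)\in E(\Gamma)$ (and no other relations). Two groups are commensurable if they have isomorphic finite index subgroups. A clique is a complete subgraph; it is proper if it is not all of $\Gamma$. Construction of $\Gamma'$. A word in $V(\Gamma)$ is reduced if it has minimal length among words representing the same element of $W_\Gamma$. Write $V(K)=\{v_1,\dots,v_k\}$ and, for $\epsilon=(\epsilon_1,\dots,\epsilon_k)\in\mathbb Z_2^k$, let $g(\epsilon)=v_1^{\epsilon_1}\cdots v_k^{\epsilon_k}$. Put $T=\{g(\epsilon)vg(\epsilon): v\in V(\Gamma)\setminus V(K),\ \epsilon\in\mathbb Z_2^k\}$ and $R=\{g(\epsilon)vg(\epsilon)\in T: g(\epsilon)vg(\epsilon)\text{ is reduced in }W_\Gamma\}$ (that is, the word $v_1^{\epsilon_1}\cdots v_k^{\epsilon_k}\,v\,v_1^{\epsilon_1}\cdots v_k^{\epsilon_k}$ is reduced). The vertex set of $\Gamma'$ is a set $R'$ in bijection with $R$; the vertex corresponding to $g(\epsilon)vg(\epsilon)\in R$ is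 denoted $v(\epsilon)$. Two vertices $u(\epsilon_1)$ and $v(\epsilon_2)$ of $\Gamma'$ (here $\epsilon_1,\epsilon_2\in\mathbb Z_2^k$) are joined by an edge if and only if $(u,v)\in E(\Gamma)$ and there is some $\epsilon\in\mathbb Z_2^k$ such that $g(\epsilon_1)ug(\epsilon_1)=g(\epsilon)ug(\epsilon)$ and $g(\epsilon_2)vg(\epsilon_2)=g(\epsilon)vg(\epsilon)$ in $W_\Gamma$. *)

theory Defs
  imports "HOL-Algebra.Coset" "Graph_Theory.Graph_Theory"
begin

section \<open>Group presentations\<close>

text \<open>A letter is a generator \<open>x\<close>, encoded as \<open>(x, True)\<close>, or a formal inverse of a generator \<open>x\<close>,
  encoded as \<open>(x, False)\<close>. A relation \<open>r = s\<close> is the pair \<open>(r, s)\<close> of words.\<close>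

type_synonym 'a word = "('a \<times> bool) list"

definition words :: "'a set \<Rightarrow> 'a word set" where
  "words S = lists (S \<times> UNIV)"

inductive pres_eq :: "'a set \<Rightarrow> ('a word \<times> 'a word) set \<Rightarrow> 'a word \<Rightarrow> 'a word \<Rightarrow> bool"
  for S :: "'a set" and Rel :: "('a word \<times> 'a word) set" where
  refl: "w \<in> words S \<Longrightarrow> pres_eq S Rel w w"
| sym: "pres_eq S Rel u w \<Longrightarrow> pres_eq S Rel w u"
| trans: "pres_eq S Rel u v \<Longrightarrow> pres_eq S Rel v w \<Longrightarrow> pres_eq S Rel u w"
| cancel: "u \<in> words S \<Longrightarrow> w \<in> words S \<Longrightarrow> x \<in> S \<Longrightarrow>
    pres_eq S Rel (u @ [(x, b), (x, \<not> b)] @ w) (u @ w)"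
| relation: "u \<in> words S \<Longrightarrow> w \<in> words S \<Longrightarrow> (r, s) \<in> Rel \<Longrightarrow> r \<in> words S \<Longrightarrow> s \<in> words S \<Longrightarrow>
    pres_eq S Rel (u @ r @ w) (u @ s @ w)"

definition pres_class :: "'a set \<Rightarrow> ('a word \<times> 'a word) set \<Rightarrow> 'a word \<Rightarrow> 'a word set" where
  "pres_class S Rel w = {w'. pres_eq S Rel w w'}"

definition presented_group :: "'a set \<Rightarrow> ('a word \<times> 'a word) set \<Rightarrow> 'a word set monoid" where
  "presented_group S Rel =
    \<lparr> carrier = pres_class S Rel ` words S,
      monoid.mult = (\<lambda>A B. \<Union>a\<in>A. \<Union>b\<in>B. pres_class S Rel (a @ b)),
      monoid.one = pres_class S Rel [] \<rparr>"


section \<open>Right-angled Coxeter groups\<close>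

definition racg_relations :: "'a pair_pre_digraph \<Rightarrow> ('a word \<times> 'a word) set" where
  "racg_relations \<Gamma> =
    {([(v, True), (v, True)], []) | v. v \<in> pverts \<Gamma>} \<union>
    {([(v1, True), (v2, True)], [(v2, True), (v1, True)]) | v1 v2. (v1, v2) \<in> parcs \<Gamma>}"

definition racg :: "'a pair_pre_digraph \<Rightarrow> 'a word set monoid" where
  "racg \<Gamma> = presented_group (pverts \<Gamma>) (racg_relations \<Gamma>)"

definition racg_elem :: "'a pair_pre_digraph \<Rightarrow> 'a list \<Rightarrow> 'a word set" where
  "racg_elem \<Gamma> w = pres_class (pverts \<Gamma>) (racg_relations \<Gamma>) (map (\<lambda>v. (v, True)) w)"

definition racg_reduced :: "'a pair_pre_digraph \<Rightarrow> 'a list \<Rightarrow> bool" where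
  "racg_reduced \<Gamma> w \<longleftrightarrow> w \<in> lists (pverts \<Gamma>) \<and>
    (\<forall>w' \<in> lists (pverts \<Gamma>). racg_elem \<Gamma> w' = racg_elem \<Gamma> w \<longrightarrow> length w \<le> length w')"


section \<open>Commensurability\<close>

definition finite_index_subgroup :: "'a set \<Rightarrow> ('a, 'm) monoid_scheme \<Rightarrow> bool" where
  "finite_index_subgroup H G \<longleftrightarrow> subgroup H G \<and> finite (rcosets\<^bsub>G\<^esub> H)"

definition commensurable :: "('a, 'm) monoid_scheme \<Rightarrow> ('b, 'n) monoid_scheme \<Rightarrow> bool" where
  "commensurable G1 G2 \<longleftrightarrow>
    (\<exists>H1 H2. finite_index_subgroup H1 G1 \<and> finite_index_subgroup H2 G2 \<and>
      G1\<lparr>carrier := H1\<rparr> \<cong> G2\<lparr>carrier := H2\<rparr>)"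


section \<open>The graph constructed from a graph and a clique\<close>

definition proper_clique :: "'a pair_pre_digraph \<Rightarrow> 'a pair_pre_digraph \<Rightarrow> bool" where
  "proper_clique K \<Gamma> \<longleftrightarrow>
    subgraph (with_proj K) (with_proj \<Gamma>) \<and> (\<exists>n. complete_digraph n (with_proj K)) \<and> K \<noteq> \<Gamma>"

text \<open>The clique vertices are enumerated by a list \<open>vs = [v\<^sub>1, \<dots>, v\<^sub>k]\<close>, and an element
  \<open>\<epsilon>\<close> of \<open>\<int>\<^sub>2\<^sup>k\<close> is a Boolean list of length \<open>k\<close>, so that \<open>clique_word vs \<epsilon>\<close> spells
  the product of the \<open>v\<^sub>i\<close> with exponents \<open>\<epsilon>\<^sub>i\<close>.\<close>

definition clique_word :: "'a list \<Rightarrow> bool list \<Rightarrow> 'a list" where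
  "clique_word vs \<epsilon> = map fst (filter snd (zip vs \<epsilon>))"

definition conj_word :: "'a list \<Rightarrow> bool list \<Rightarrow> 'a \<Rightarrow> 'a list" where
  "conj_word vs \<epsilon> v = clique_word vs \<epsilon> @ [v] @ clique_word vs \<epsilon>"

text \<open>The elements of \<open>R\<close> themselves serve as the vertices of the new graph: the vertex \<open>v(\<epsilon>)\<close> is
  the group element represented by \<open>conj_word vs \<epsilon> v\<close>, where this word is reduced. In the arc
  condition, the common \<open>\<epsilon>\<close> need not give reduced words.\<close>

definition clique_graph_verts :: "'a pair_pre_digraph \<Rightarrow> 'a list \<Rightarrow> 'a word set set" where
  "clique_graph_verts \<Gamma> vs =
    {racg_elem \<Gamma> (conj_word vs \<epsilon> v) | v \<epsilon>.
      v \<in> pverts \<Gamma> - set vs \<and> length \<epsilon> = length vs \<and> racg_reduced \<Gamma> (conj_word vs \<epsilon> v)}"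

definition clique_graph_arcs :: "'a pair_pre_digraph \<Rightarrow> 'a list \<Rightarrow> 'a word set rel" where
  "clique_graph_arcs \<Gamma> vs =
    {(racg_elem \<Gamma> (conj_word vs \<epsilon>1 u), racg_elem \<Gamma> (conj_word vs \<epsilon>2 v)) | u \<epsilon>1 v \<epsilon>2.
      u \<in> pverts \<Gamma> - set vs \<and> length \<epsilon>1 = length vs \<and> racg_reduced \<Gamma> (conj_word vs \<epsilon>1 u) \<and>
      v \<in> pverts \<Gamma> - set vs \<and> length \<epsilon>2 = length vs \<and> racg_reduced \<Gamma> (conj_word vs \<epsilon>2 v) \<and>
      (u, v) \<in> parcs \<Gamma> \<and>
      (\<exists>\<epsilon>. length \<epsilon> = length vs \<and>
        racg_elem \<Gamma> (conj_word vs \<epsilon>1 u) = racg_elem \<Gamma> (conj_word vs \<epsilon> u) \<and>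
        racg_elem \<Gamma> (conj_word vs \<epsilon>2 v) = racg_elem \<Gamma> (conj_word vs \<epsilon> v))}"

definition clique_graph :: "'a pair_pre_digraph \<Rightarrow> 'a list \<Rightarrow> 'a word set pair_pre_digraph" where
  "clique_graph \<Gamma> vs =
    \<lparr> pverts = clique_graph_verts \<Gamma> vs, parcs = clique_graph_arcs \<Gamma> vs \<rparr>"

end

theory Submission
  imports Defs
begin

text \<open>
  Write \<open>C\<close> for the finite subgroup of \<open>W\<^sub>\<Gamma>\<close> generated by the clique. Killing all generators
  outside the clique retracts \<open>W\<^sub>\<Gamma>\<close> onto \<open>C\<close>, and the kernel \<open>N\<close> of this retraction is generated by
  the conjugates \<open>a u a\<close> with \<open>a\<close> in \<open>C\<close> and \<open>u\<close> outside the clique. These conjugates are the vertices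
  of \<open>\<Gamma>'\<close>, and \<open>N\<close> turns out to be the right-angled Coxeter group \<open>W'\<close> of \<open>\<Gamma>'\<close>. So \<open>W\<^sub>\<Gamma>\<close> contains
  a copy of \<open>W'\<close> of index at most \<open>card C\<close>, and the two groups are commensurable.

  The retraction itself is never formed. Every vertex of \<open>\<Gamma>'\<close> is an element of \<open>W\<^sub>\<Gamma>\<close>, which gives a
  homomorphism \<open>embed\<close> from \<open>W'\<close> to \<open>W\<^sub>\<Gamma>\<close>. Two facts are needed about it.

  Its image has finite index, because every element of \<open>W\<^sub>\<Gamma>\<close> is an element of the image times an
  element of \<open>C\<close> (\<open>embed_image_factor\<close>): reading a word letter by letter, \<open>h a u = h (a u a) a\<close>.

  It is injective, because \<open>W\<^sub>\<Gamma>\<close> acts on the set \<open>W'\<close> in such a way that \<open>embed n\<close> acts as left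
  multiplication by \<open>n\<close> (\<open>embed_acts_by_left_mult\<close>). A vertex outside the clique acts by left
  multiplication, a clique vertex \<open>x\<close> by the automorphism of \<open>W'\<close> that comes from conjugating the
  vertices of \<open>\<Gamma>'\<close> by \<open>x\<close>. This is the action on \<open>W\<^sub>\<Gamma> / C\<close> that one expects if \<open>W\<^sub>\<Gamma>\<close> is the
  semidirect product of \<open>W'\<close> and \<open>C\<close>.

  The automorphisms exist because \<open>\<Gamma>'\<close> is invariant under conjugation by \<open>C\<close>. That invariance is
  hidden by the restriction to reduced words in the construction of \<open>\<Gamma>'\<close>. Dropping from \<open>a\<close> the
  clique vertices adjacent to \<open>u\<close> does not change \<open>a u a\<close> and makes the word reduced
  (\<open>reduced_representative\<close>), so the restriction can be omitted (\<open>clique_graph_verts_eq\<close>,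
  \<open>clique_graph_arcs_eq\<close>).
\<close>


section \<open>Presented groups\<close>

lemma words_simps [simp]:
  "[] \<in> words S"
  "p # w \<in> words S \<longleftrightarrow> fst p \<in> S \<and> w \<in> words S"
  "u @ w \<in> words S \<longleftrightarrow> u \<in> words S \<and> w \<in> words S"
  by (auto simp: words_def mem_Times_iff)

lemma pres_eq_imp_words: "pres_eq S Rel u w \<Longrightarrow> u \<in> words S \<and> w \<in> words S"
  by (induction rule: pres_eq.induct) auto

lemma pres_eq_append_left:
  "pres_eq S Rel u w \<Longrightarrow> a \<in> words S \<Longrightarrow> pres_eq S Rel (a @ u) (a @ w)"
proof (induction rule: pres_eq.induct)
  case (cancel u w x b)
  then show ?case using pres_eq.cancel[of "a @ u" S w x Rel b] by simp
next
  case (relation u w r s)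
  then show ?case using pres_eq.relation[of "a @ u" S w r s Rel] by simp
qed (simp_all add: pres_eq.refl pres_eq.sym, blast intro: pres_eq.trans)

lemma pres_eq_append_right:
  "pres_eq S Rel u w \<Longrightarrow> a \<in> words S \<Longrightarrow> pres_eq S Rel (u @ a) (w @ a)"
proof (induction rule: pres_eq.induct)
  case (cancel u w x b)
  then show ?case using pres_eq.cancel[of u S "w @ a" x Rel b] by simp
next
  case (relation u w r s)
  then show ?case using pres_eq.relation[of u S "w @ a" r s Rel] by simp
qed (simp_all add: pres_eq.refl pres_eq.sym, blast intro: pres_eq.trans)

lemma pres_class_eq_iff:
  "w \<in> words S \<Longrightarrow> pres_class S Rel u = pres_class S Rel w \<longleftrightarrow> pres_eq S Rel u w"
  unfolding pres_class_def by (auto intro: pres_eq.refl) (meson pres_eq.sym pres_eq.trans)+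

lemma presented_group_mult:
  assumes "u \<in> words S" "w \<in> words S"
  shows "pres_class S Rel u \<otimes>\<^bsub>presented_group S Rel\<^esub> pres_class S Rel w
    = pres_class S Rel (u @ w)"
proof -
  have "pres_class S Rel (a @ b) = pres_class S Rel (u @ w)"
    if "a \<in> pres_class S Rel u" "b \<in> pres_class S Rel w" for a b
  proof -
    have ab: "pres_eq S Rel u a" "pres_eq S Rel w b"
      using that by (auto simp: pres_class_def)
    have "a \<in> words S"
      using pres_eq_imp_words[OF ab(1)] by blast
    then have "pres_eq S Rel (u @ w) (a @ b)"
      by (rule pres_eq.trans[OF pres_eq_append_right[OF ab(1) assms(2)]
            pres_eq_append_left[OF ab(2)]])
    then show ?thesis
      using assms by (simp add: pres_class_eq_iff pres_eq.sym)
  qed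
  moreover have "u \<in> pres_class S Rel u" "w \<in> pres_class S Rel w"
    using assms by (auto simp: pres_class_def intro: pres_eq.refl)
  ultimately have "(\<Union>a\<in>pres_class S Rel u. \<Union>b\<in>pres_class S Rel w. pres_class S Rel (a @ b))
      = pres_class S Rel (u @ w)"
    by blast
  then show ?thesis
    by (simp add: presented_group_def)
qed

lemma presented_group_carrier:
  "carrier (presented_group S Rel) = pres_class S Rel ` words S"
  by (simp add: presented_group_def)

lemma presented_group_one:
  "\<one>\<^bsub>presented_group S Rel\<^esub> = pres_class S Rel []"
  by (simp add: presented_group_def)

definition inverse_word :: "'a word \<Rightarrow> 'a word" where
  "inverse_word w = rev (map (\<lambda>(x, b). (x, \<not> b)) w)"

lemma inverse_word_in_words: "w \<in> words S \<Longrightarrow> inverse_word w \<in> words S"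
  by (induction w) (auto simp: inverse_word_def)

lemma pres_eq_inverse_word:
  "w \<in> words S \<Longrightarrow> pres_eq S Rel (inverse_word w @ w) []"
proof (induction w)
  case Nil
  then show ?case by (simp add: inverse_word_def pres_eq.refl)
next
  case (Cons p w)
  obtain x b where p: "p = (x, b)" by (cases p)
  have "pres_eq S Rel (inverse_word w @ [(x, \<not> b), (x, \<not> \<not> b)] @ w) (inverse_word w @ w)"
    using Cons.prems by (intro pres_eq.cancel) (auto simp: p inverse_word_in_words)
  then show ?case
    using Cons pres_eq.trans by (fastforce simp: p inverse_word_def)
qed

lemma group_presented_group: "group (presented_group S Rel)"
proof (rule groupI; unfold presented_group_one presented_group_carrier)
  fix A assume "A \<in> pres_class S Rel ` words S"
  then obtain w where w: "w \<in> words S" "A = pres_class S Rel w" by auto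
  have "pres_class S Rel (inverse_word w) \<otimes>\<^bsub>presented_group S Rel\<^esub> A = pres_class S Rel []"
    using w by (simp add: presented_group_mult inverse_word_in_words pres_class_eq_iff
        pres_eq_inverse_word)
  then show "\<exists>B\<in>pres_class S Rel ` words S.
      B \<otimes>\<^bsub>presented_group S Rel\<^esub> A = pres_class S Rel []"
    using w by (auto simp: inverse_word_in_words)
qed (auto simp: presented_group_mult)


section \<open>Right-angled Coxeter groups\<close>

lemma group_racg: "group (racg \<Gamma>)"
  by (simp add: racg_def group_presented_group)

lemma map_letters_in_words: "map (\<lambda>v. (v, True)) w \<in> words S \<longleftrightarrow> w \<in> lists S"
  by (induction w) auto

lemma map_fst_words: "w \<in> words S \<Longrightarrow> map fst w \<in> lists S"
  by (induction w) auto

lemma racg_one: "\<one>\<^bsub>racg \<Gamma>\<^esub> = racg_elem \<Gamma> []"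
  by (simp add: racg_def racg_elem_def presented_group_one)

lemma racg_mult:
  "u \<in> lists (pverts \<Gamma>) \<Longrightarrow> w \<in> lists (pverts \<Gamma>) \<Longrightarrow>
    racg_elem \<Gamma> u \<otimes>\<^bsub>racg \<Gamma>\<^esub> racg_elem \<Gamma> w = racg_elem \<Gamma> (u @ w)"
  by (simp add: racg_def racg_elem_def presented_group_mult map_letters_in_words)

lemma racg_elem_carrier [simp]:
  "w \<in> lists (pverts \<Gamma>) \<Longrightarrow> racg_elem \<Gamma> w \<in> carrier (racg \<Gamma>)"
  by (simp add: racg_def racg_elem_def presented_group_carrier map_letters_in_words)

lemma racg_elem_square:
  assumes "x \<in> pverts \<Gamma>"
  shows "racg_elem \<Gamma> [x] \<otimes>\<^bsub>racg \<Gamma>\<^esub> racg_elem \<Gamma> [x] = \<one>\<^bsub>racg \<Gamma>\<^esub>"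
proof -
  have "([(x, True), (x, True)], []) \<in> racg_relations \<Gamma>"
    using assms by (auto simp: racg_relations_def)
  then have "pres_eq (pverts \<Gamma>) (racg_relations \<Gamma>) [(x, True), (x, True)] []"
    using assms pres_eq.relation[of "[]" "pverts \<Gamma>" "[]"] by fastforce
  then show ?thesis
    using assms by (simp add: racg_mult racg_one) (simp add: racg_elem_def pres_class_eq_iff)
qed

lemma racg_elem_commute:
  assumes "(x, y) \<in> parcs \<Gamma>" "x \<in> pverts \<Gamma>" "y \<in> pverts \<Gamma>"
  shows "racg_elem \<Gamma> [x] \<otimes>\<^bsub>racg \<Gamma>\<^esub> racg_elem \<Gamma> [y]
    = racg_elem \<Gamma> [y] \<otimes>\<^bsub>racg \<Gamma>\<^esub> racg_elem \<Gamma> [x]"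
proof -
  have "([(x, True), (y, True)], [(y, True), (x, True)]) \<in> racg_relations \<Gamma>"
    using assms by (auto simp: racg_relations_def)
  then have "pres_eq (pverts \<Gamma>) (racg_relations \<Gamma>)
      [(x, True), (y, True)] [(y, True), (x, True)]"
    using assms pres_eq.relation[of "[]" "pverts \<Gamma>" "[]"] by fastforce
  then show ?thesis
    using assms by (simp add: racg_mult) (simp add: racg_elem_def pres_class_eq_iff)
qed

text \<open>Generators are involutions, so formal inverses may be dropped from every word.\<close>

lemma racg_class_eq_elem:
  "w \<in> words (pverts \<Gamma>) \<Longrightarrow>
    pres_class (pverts \<Gamma>) (racg_relations \<Gamma>) w = racg_elem \<Gamma> (map fst w)"
proof (induction w)
  case Nil
  then show ?case by (simp add: racg_elem_def)
next
  case (Cons p w)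
  let ?V = "pverts \<Gamma>" and ?R = "racg_relations \<Gamma>"
  obtain x b where p: "p = (x, b)" by (cases p)
  have x: "x \<in> ?V" and w: "w \<in> words ?V" "map fst w \<in> lists ?V"
    using Cons.prems by (auto simp: p map_fst_words)
  have rel: "([(x, True), (x, True)], []) \<in> ?R"
    using x by (auto simp: racg_relations_def)
  have "pres_eq ?V ?R ([(x, False)] @ [(x, True), (x, True)] @ []) ([(x, False)] @ [] @ [])"
    using x rel by (intro pres_eq.relation) auto
  then have "pres_eq ?V ?R [(x, False), (x, True), (x, True)] [(x, False)]"
    by simp
  moreover have "pres_eq ?V ?R ([] @ [(x, False), (x, \<not> False)] @ [(x, True)]) ([] @ [(x, True)])"
    using x by (intro pres_eq.cancel) auto
  then have "pres_eq ?V ?R [(x, False), (x, True), (x, True)] [(x, True)]"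
    by simp
  ultimately have "pres_eq ?V ?R [(x, False)] [(x, True)]"
    by (rule pres_eq.trans[OF pres_eq.sym])
  then have letter: "pres_class ?V ?R [(x, b)] = racg_elem \<Gamma> [x]"
    using x by (cases b) (auto simp: racg_elem_def pres_class_eq_iff)
  have "pres_class ?V ?R (p # w) = pres_class ?V ?R [(x, b)] \<otimes>\<^bsub>racg \<Gamma>\<^esub> pres_class ?V ?R w"
    using x w by (simp add: racg_def presented_group_mult p)
  also have "\<dots> = racg_elem \<Gamma> (map fst (p # w))"
    using x w Cons.IH by (simp add: letter racg_mult p)
  finally show ?case .
qed

lemma racg_carrier: "carrier (racg \<Gamma>) = racg_elem \<Gamma> ` lists (pverts \<Gamma>)"
proof
  show "carrier (racg \<Gamma>) \<subseteq> racg_elem \<Gamma> ` lists (pverts \<Gamma>)"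
  proof
    fix A assume "A \<in> carrier (racg \<Gamma>)"
    then obtain w where w: "w \<in> words (pverts \<Gamma>)"
      "A = pres_class (pverts \<Gamma>) (racg_relations \<Gamma>) w"
      by (auto simp: racg_def presented_group_carrier)
    have "map fst w \<in> lists (pverts \<Gamma>)"
      by (rule map_fst_words[OF w(1)])
    then show "A \<in> racg_elem \<Gamma> ` lists (pverts \<Gamma>)"
      using w by (simp add: racg_class_eq_elem)
  qed
  show "racg_elem \<Gamma> ` lists (pverts \<Gamma>) \<subseteq> carrier (racg \<Gamma>)"
    by (rule image_subsetI) (rule racg_elem_carrier)
qed

lemma racg_elem_Cons:
  "x \<in> pverts \<Gamma> \<Longrightarrow> w \<in> lists (pverts \<Gamma>) \<Longrightarrow>
    racg_elem \<Gamma> (x # w) = racg_elem \<Gamma> [x] \<otimes>\<^bsub>racg \<Gamma>\<^esub> racg_elem \<Gamma> w"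
  by (simp add: racg_mult)

lemma racg_induct [consumes 1, case_names one gen]:
  assumes "n \<in> carrier (racg \<Gamma>)"
    and "P \<one>\<^bsub>racg \<Gamma>\<^esub>"
    and "\<And>x m. x \<in> pverts \<Gamma> \<Longrightarrow> m \<in> carrier (racg \<Gamma>) \<Longrightarrow> P m \<Longrightarrow>
      P (racg_elem \<Gamma> [x] \<otimes>\<^bsub>racg \<Gamma>\<^esub> m)"
  shows "P n"
proof -
  have "P (racg_elem \<Gamma> w)" if "w \<in> lists (pverts \<Gamma>)" for w
    using that
  proof induction
    case Nil
    then show ?case using assms(2) by (simp add: racg_one)
  next
    case (Cons x w)
    then show ?case using assms(3) racg_elem_Cons[of x \<Gamma> w] by auto
  qed
  then show ?thesis using assms(1) by (auto simp: racg_carrier)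
qed

text \<open>The universal property in the form of an action: each defining relation holds for the maps
  \<open>act x\<close>, hence so does each of their consequences. It serves both to define homomorphisms and to
  tell elements of the group apart.\<close>

lemma racg_action_well_defined:
  fixes act :: "'a \<Rightarrow> 'b \<Rightarrow> 'b"
  assumes closed: "\<And>x p. x \<in> pverts \<Gamma> \<Longrightarrow> p \<in> X \<Longrightarrow> act x p \<in> X"
    and invol: "\<And>x p. x \<in> pverts \<Gamma> \<Longrightarrow> p \<in> X \<Longrightarrow> act x (act x p) = p"
    and comm: "\<And>x y p. (x, y) \<in> parcs \<Gamma> \<Longrightarrow> x \<in> pverts \<Gamma> \<Longrightarrow> y \<in> pverts \<Gamma> \<Longrightarrow> p \<in> X \<Longrightarrow>
      act x (act y p) = act y (act x p)"
    and eq: "racg_elem \<Gamma> u = racg_elem \<Gamma> w"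
    and u: "u \<in> lists (pverts \<Gamma>)" and w: "w \<in> lists (pverts \<Gamma>)" and p: "p \<in> X"
  shows "foldr act u p = foldr act w p"
proof -
  let ?run = "\<lambda>w :: 'a word. foldr act (map fst w)"
  have run_closed: "?run a q \<in> X" if "a \<in> words (pverts \<Gamma>)" "q \<in> X" for a q
    using that by (induction a) (auto simp: closed)
  have run_eq: "\<forall>q\<in>X. ?run a q = ?run b q"
    if "pres_eq (pverts \<Gamma>) (racg_relations \<Gamma>) a b" for a b
    using that
  proof induction
    case (cancel u w x b)
    then show ?case by (simp add: invol run_closed)
  next
    case (relation u w r s)
    from \<open>(r, s) \<in> racg_relations \<Gamma>\<close> consider
        v where "r = [(v, True), (v, True)]" "s = []" "v \<in> pverts \<Gamma>"
      | v1 v2 where "r = [(v1, True), (v2, True)]" "s = [(v2, True), (v1, True)]"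
          "(v1, v2) \<in> parcs \<Gamma>"
      by (auto simp: racg_relations_def)
    then show ?case
    proof cases
      case 1
      then show ?thesis using relation by (simp add: invol run_closed)
    next
      case 2
      then show ?thesis using relation comm[of v1 v2] by (simp add: run_closed)
    qed
  qed auto
  have "pres_eq (pverts \<Gamma>) (racg_relations \<Gamma>) (map (\<lambda>v. (v, True)) u) (map (\<lambda>v. (v, True)) w)"
    using eq w by (simp add: racg_elem_def pres_class_eq_iff map_letters_in_words)
  from run_eq[OF this] p show ?thesis by (simp add: comp_def)
qed

text \<open>If \<open>f\<close> respects the defining relations, this is the homomorphism extending it, and the choice of
  the word does not matter: \<open>racg_action_well_defined\<close> applies to left multiplication by the
  elements \<open>f x\<close> of \<open>H\<close>.\<close>

definition racg_lift ::
  "'a pair_pre_digraph \<Rightarrow> ('b, 'm) monoid_scheme \<Rightarrow> ('a \<Rightarrow> 'b) \<Rightarrow> 'a word set \<Rightarrow> 'b" where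
  "racg_lift \<Gamma> H f A =
    foldr (\<lambda>x. (\<otimes>\<^bsub>H\<^esub>) (f x)) (SOME w. w \<in> lists (pverts \<Gamma>) \<and> racg_elem \<Gamma> w = A) \<one>\<^bsub>H\<^esub>"

lemma racg_lift:
  fixes \<Gamma> :: "'a pair_pre_digraph" and H :: "('b, 'm) monoid_scheme"
  assumes "group H"
    and carr: "\<And>x. x \<in> pverts \<Gamma> \<Longrightarrow> f x \<in> carrier H"
    and invol: "\<And>x. x \<in> pverts \<Gamma> \<Longrightarrow> f x \<otimes>\<^bsub>H\<^esub> f x = \<one>\<^bsub>H\<^esub>"
    and comm: "\<And>x y. (x, y) \<in> parcs \<Gamma> \<Longrightarrow> x \<in> pverts \<Gamma> \<Longrightarrow> y \<in> pverts \<Gamma> \<Longrightarrow>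
      f x \<otimes>\<^bsub>H\<^esub> f y = f y \<otimes>\<^bsub>H\<^esub> f x"
  shows racg_lift_hom: "racg_lift \<Gamma> H f \<in> hom (racg \<Gamma>) H"
    and racg_lift_gen: "\<And>x. x \<in> pverts \<Gamma> \<Longrightarrow> racg_lift \<Gamma> H f (racg_elem \<Gamma> [x]) = f x"
proof -
  interpret H: group H by fact
  let ?act = "\<lambda>x. (\<otimes>\<^bsub>H\<^esub>) (f x)"
  have lift: "racg_lift \<Gamma> H f (racg_elem \<Gamma> w) = foldr ?act w \<one>\<^bsub>H\<^esub>"
    if w: "w \<in> lists (pverts \<Gamma>)" for w
  proof -
    let ?u = "SOME u. u \<in> lists (pverts \<Gamma>) \<and> racg_elem \<Gamma> u = racg_elem \<Gamma> w"
    have u: "?u \<in> lists (pverts \<Gamma>) \<and> racg_elem \<Gamma> ?u = racg_elem \<Gamma> w"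
      by (rule someI[of _ w]) (use w in auto)
    have "foldr ?act ?u \<one>\<^bsub>H\<^esub> = foldr ?act w \<one>\<^bsub>H\<^esub>"
    proof (rule racg_action_well_defined[where X = "carrier H"])
      show "?act x (?act x p) = p" if "x \<in> pverts \<Gamma>" "p \<in> carrier H" for x p
        using that by (simp add: carr invol flip: H.m_assoc)
      show "?act x (?act y p) = ?act y (?act x p)"
        if "(x, y) \<in> parcs \<Gamma>" "x \<in> pverts \<Gamma>" "y \<in> pverts \<Gamma>" "p \<in> carrier H" for x y p
        using that by (simp add: carr comm[OF that(1-3)] flip: H.m_assoc)
    qed (use u w carr in auto)
    then show ?thesis by (simp add: racg_lift_def)
  qed
  have closed: "foldr ?act w \<one>\<^bsub>H\<^esub> \<in> carrier H" if "w \<in> lists (pverts \<Gamma>)" for w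
    using that by induction (auto simp: carr)
  have append: "foldr ?act (u @ w) \<one>\<^bsub>H\<^esub> = foldr ?act u \<one>\<^bsub>H\<^esub> \<otimes>\<^bsub>H\<^esub> foldr ?act w \<one>\<^bsub>H\<^esub>"
    if "u \<in> lists (pverts \<Gamma>)" "w \<in> lists (pverts \<Gamma>)" for u w
    using that(1) by induction (use that(2) in \<open>auto simp: closed carr H.m_assoc simp del: foldr_append\<close>)
  show "racg_lift \<Gamma> H f \<in> hom (racg \<Gamma>) H"
  proof (rule homI; unfold racg_carrier)
    fix A B
    assume "A \<in> racg_elem \<Gamma> ` lists (pverts \<Gamma>)" "B \<in> racg_elem \<Gamma> ` lists (pverts \<Gamma>)"
    then obtain u w where u: "u \<in> lists (pverts \<Gamma>)" "A = racg_elem \<Gamma> u"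
      and w: "w \<in> lists (pverts \<Gamma>)" "B = racg_elem \<Gamma> w" by blast
    then have "u @ w \<in> lists (pverts \<Gamma>)" by simp
    then show "racg_lift \<Gamma> H f (A \<otimes>\<^bsub>racg \<Gamma>\<^esub> B) = racg_lift \<Gamma> H f A \<otimes>\<^bsub>H\<^esub> racg_lift \<Gamma> H f B"
      using u w lift append[OF u(1) w(1)] racg_mult[OF u(1) w(1)] by simp
  next
    fix A assume "A \<in> racg_elem \<Gamma> ` lists (pverts \<Gamma>)"
    then show "racg_lift \<Gamma> H f A \<in> carrier H"
      using lift closed by force
  qed
  show "racg_lift \<Gamma> H f (racg_elem \<Gamma> [x]) = f x" if "x \<in> pverts \<Gamma>" for x
    using that by (simp add: lift carr)
qed

text \<open>The parity of the number of occurrences of a letter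
  is an invariant of the element, so \<open>u\<close> must occur, and each letter of \<open>g\<close> must occur twice unless it
  does not occur at all. The latter is excluded by passing to the infinite dihedral group on \<open>u\<close>
  and that letter. So a word for this element has at least \<open>2 * length g + 1\<close> letters.\<close>

lemma racg_reduced_conj:
  assumes g: "g \<in> lists (pverts \<Gamma>)" "distinct g" and u: "u \<in> pverts \<Gamma>" "u \<notin> set g"
    and nonadj: "\<And>x. x \<in> set g \<Longrightarrow> (x, u) \<notin> parcs \<Gamma> \<and> (u, x) \<notin> parcs \<Gamma>"
  shows "racg_reduced \<Gamma> (g @ [u] @ g)"
  unfolding racg_reduced_def
proof (intro conjI ballI impI)
  show "g @ [u] @ g \<in> lists (pverts \<Gamma>)" using g u by auto
  then have conj_word: "g @ [u] @ g \<in> lists (pverts \<Gamma>)" .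
  fix w assume w: "w \<in> lists (pverts \<Gamma>)" and eq: "racg_elem \<Gamma> w = racg_elem \<Gamma> (g @ [u] @ g)"
  have parity: "even (count_list w x) \<longleftrightarrow> even (count_list (g @ [u] @ g) x)" for x
  proof -
    let ?flip = "\<lambda>y b. if y = x then \<not> b else b"
    have "foldr ?flip w True = foldr ?flip (g @ [u] @ g) True"
      by (rule racg_action_well_defined[OF _ _ _ eq w conj_word, where X = UNIV]) auto
    moreover have "foldr ?flip a True \<longleftrightarrow> even (count_list a x)" for a
      by (induction a) auto
    ultimately show ?thesis by simp
  qed
  have two: "2 \<le> count_list w x" if x: "x \<in> set g" for x
  proof -
    \<comment> \<open>The symmetric group on \<open>{0, 1, 2}\<close> is a quotient of the infinite dihedral group generated by
      \<open>u\<close> and \<open>x\<close>. In it \<open>x u x\<close> moves the point 2, which is fixed by all powers of \<open>u\<close>.\<close>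
    let ?act = "\<lambda>y. if y = u then Transposition.transpose (0 :: nat) 1
      else if y = x then Transposition.transpose 1 2 else id"
    have "u \<noteq> x" using x u by auto
    have "foldr ?act w 2 = foldr ?act (g @ [u] @ g) 2"
      by (rule racg_action_well_defined[OF _ _ _ eq w conj_word, where X = UNIV])
        (use nonadj[OF x] in auto)
    moreover have "foldr ?act a p = (if x \<in> set a then Transposition.transpose 1 2 p else p)"
      if "distinct a" "u \<notin> set a" for a p
      using that by (induction a) auto
    then have "foldr ?act (g @ [u] @ g) 2 = 0"
      using g u x \<open>u \<noteq> x\<close> by (simp add: transpose_def)
    moreover have "foldr ?act a 2 = 2" if "x \<notin> set a" for a
      using that by (induction a) (auto simp: transpose_def)
    ultimately have "x \<in> set w" by fastforce
    then have "count_list w x \<noteq> 0" by (simp add: count_list_0_iff)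
    moreover have "even (count_list w x)"
      using parity[of x] \<open>u \<noteq> x\<close> by simp
    ultimately show ?thesis by presburger
  qed
  have one: "1 \<le> count_list w u"
  proof -
    have "odd (count_list w u)" using parity[of u] u by simp
    then show ?thesis by presburger
  qed
  have "length (g @ [u] @ g) = 1 + (\<Sum>x\<in>set g. 2)"
    using distinct_card[OF g(2)] by simp
  also have "\<dots> \<le> count_list w u + (\<Sum>x\<in>set g. count_list w x)"
    using one two by (intro add_mono sum_mono) auto
  also have "\<dots> = sum (count_list w) (insert u (set g))"
    using u by simp
  also have "\<dots> \<le> sum (count_list w) (set w \<union> insert u (set g))"
    by (rule sum_mono2) auto
  also have "\<dots> = length w"
    by (rule sum_count_set) auto
  finally show "length (g @ [u] @ g) \<le> length w" .
qed

section \<open>The group of the clique\<close>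

locale clique_in_graph =
  fixes \<Gamma> :: "'a pair_pre_digraph" and vs :: "'a list"
  assumes arcs_sym: "(u, v) \<in> parcs \<Gamma> \<Longrightarrow> (v, u) \<in> parcs \<Gamma>"
    and arcs_verts: "(u, v) \<in> parcs \<Gamma> \<Longrightarrow> u \<in> pverts \<Gamma>"
    and vs_verts: "set vs \<subseteq> pverts \<Gamma>"
    and vs_distinct: "distinct vs"
    and vs_clique: "x \<in> set vs \<Longrightarrow> y \<in> set vs \<Longrightarrow> x \<noteq> y \<Longrightarrow> (x, y) \<in> parcs \<Gamma>"
begin

abbreviation "W \<equiv> racg \<Gamma>"
abbreviation "cl \<equiv> racg_elem \<Gamma>"
abbreviation "\<Gamma>' \<equiv> clique_graph \<Gamma> vs"
abbreviation "W' \<equiv> racg \<Gamma>'"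
abbreviation "cl' \<equiv> racg_elem \<Gamma>'"

interpretation W: group W by (rule group_racg)
interpretation W': group W' by (rule group_racg)

definition clique_group :: "'a word set set" where
  "clique_group = cl ` lists (set vs)"

lemma lists_vs_verts: "g \<in> lists (set vs) \<Longrightarrow> g \<in> lists (pverts \<Gamma>)"
  using vs_verts by auto

lemma clique_group_carrier [simp]: "a \<in> clique_group \<Longrightarrow> a \<in> carrier W"
  unfolding clique_group_def by (erule imageE) (simp only: racg_elem_carrier lists_vs_verts)

lemma clique_group_one [simp]: "\<one>\<^bsub>W\<^esub> \<in> clique_group"
  by (auto simp: clique_group_def racg_one)

lemma clique_group_gen [simp]: "x \<in> set vs \<Longrightarrow> cl [x] \<in> clique_group"
  by (auto simp: clique_group_def)

lemma clique_group_mult [simp]: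
  assumes "a \<in> clique_group" "b \<in> clique_group"
  shows "a \<otimes>\<^bsub>W\<^esub> b \<in> clique_group"
proof -
  from assms obtain g h where g: "g \<in> lists (set vs)" "a = cl g"
    and h: "h \<in> lists (set vs)" "b = cl h"
    by (auto simp: clique_group_def)
  then have "a \<otimes>\<^bsub>W\<^esub> b = cl (g @ h)"
    using racg_mult[OF lists_vs_verts[OF g(1)] lists_vs_verts[OF h(1)]] by simp
  then show ?thesis unfolding clique_group_def using g h by (auto intro!: imageI)
qed

lemma clique_gen_commute:
  assumes "x \<in> set vs" "a \<in> clique_group"
  shows "cl [x] \<otimes>\<^bsub>W\<^esub> a = a \<otimes>\<^bsub>W\<^esub> cl [x]"
proof -
  have x: "x \<in> pverts \<Gamma>" using assms vs_verts by auto
  have "cl [x] \<otimes>\<^bsub>W\<^esub> cl g = cl g \<otimes>\<^bsub>W\<^esub> cl [x]" if "g \<in> lists (set vs)" for g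
    using that
  proof induction
    case Nil
    then show ?case using x by (simp flip: racg_one)
  next
    case (Cons y g)
    have y: "y \<in> pverts \<Gamma>" and g: "g \<in> lists (pverts \<Gamma>)"
      using Cons vs_verts lists_vs_verts by auto
    have "cl [x] \<otimes>\<^bsub>W\<^esub> cl [y] = cl [y] \<otimes>\<^bsub>W\<^esub> cl [x]"
      using racg_elem_commute[OF vs_clique[OF assms(1) Cons.hyps(1)] x y] by (cases "x = y") simp_all
    then have "cl [x] \<otimes>\<^bsub>W\<^esub> (cl [y] \<otimes>\<^bsub>W\<^esub> cl g) = cl [y] \<otimes>\<^bsub>W\<^esub> (cl [x] \<otimes>\<^bsub>W\<^esub> cl g)"
      using x y g by (simp flip: W.m_assoc)
    then show ?case
      using x y g Cons.IH by (subst (1 2) racg_elem_Cons) (auto simp: W.m_assoc)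
  qed
  then show ?thesis using assms by (auto simp: clique_group_def)
qed

lemma clique_group_commute:
  assumes "a \<in> clique_group" "b \<in> clique_group"
  shows "a \<otimes>\<^bsub>W\<^esub> b = b \<otimes>\<^bsub>W\<^esub> a"
proof -
  have "cl g \<otimes>\<^bsub>W\<^esub> b = b \<otimes>\<^bsub>W\<^esub> cl g" if "g \<in> lists (set vs)" for g
    using that
  proof induction
    case Nil
    then show ?case using assms by (simp flip: racg_one)
  next
    case (Cons x g)
    have x: "x \<in> pverts \<Gamma>" and g: "g \<in> lists (pverts \<Gamma>)"
      using Cons vs_verts lists_vs_verts by auto
    have "cl [x] \<otimes>\<^bsub>W\<^esub> (b \<otimes>\<^bsub>W\<^esub> cl g) = b \<otimes>\<^bsub>W\<^esub> (cl [x] \<otimes>\<^bsub>W\<^esub> cl g)"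
      using x g assms clique_gen_commute[OF \<open>x \<in> set vs\<close> assms(2)] by (simp flip: W.m_assoc)
    then show ?case
      using x g assms Cons.IH by (subst (1 2) racg_elem_Cons) (auto simp: W.m_assoc)
  qed
  then show ?thesis using assms by (auto simp: clique_group_def)
qed

lemma clique_group_square:
  assumes "a \<in> clique_group"
  shows "a \<otimes>\<^bsub>W\<^esub> a = \<one>\<^bsub>W\<^esub>"
proof -
  have "cl g \<otimes>\<^bsub>W\<^esub> cl g = \<one>\<^bsub>W\<^esub>" if "g \<in> lists (set vs)" for g
    using that
  proof induction
    case Nil
    then show ?case by (simp flip: racg_one)
  next
    case (Cons x g)
    have x: "x \<in> pverts \<Gamma>" and g: "g \<in> lists (pverts \<Gamma>)"
      using Cons vs_verts lists_vs_verts by auto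
    have "cl g \<in> clique_group" using Cons by (auto simp: clique_group_def)
    note comm = clique_gen_commute[OF \<open>x \<in> set vs\<close> this]
    have "(cl [x] \<otimes>\<^bsub>W\<^esub> cl g) \<otimes>\<^bsub>W\<^esub> (cl [x] \<otimes>\<^bsub>W\<^esub> cl g)
        = (cl g \<otimes>\<^bsub>W\<^esub> (cl [x] \<otimes>\<^bsub>W\<^esub> cl [x])) \<otimes>\<^bsub>W\<^esub> cl g"
      using x g by (simp add: comm W.m_assoc)
    then show ?case
      using x g Cons.IH by (subst (1 2) racg_elem_Cons) (auto simp: racg_elem_square)
  qed
  then show ?thesis using assms by (auto simp: clique_group_def)
qed

lemma clique_word_lists: "clique_word us \<epsilon> \<in> lists (set us)"
  using set_zip_leftD by (fastforce simp: clique_word_def)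

lemma clique_word_clique_group [simp]: "cl (clique_word vs \<epsilon>) \<in> clique_group"
  unfolding clique_group_def using clique_word_lists by (rule imageI)

lemma clique_word_Cons:
  "clique_word (u # us) (e # \<epsilon>) = (if e then u # clique_word us \<epsilon> else clique_word us \<epsilon>)"
  by (simp add: clique_word_def)

text \<open>The clique group is elementary abelian, so multiplying by a generator \<open>x\<close> flips the exponent
  of \<open>x\<close>.\<close>

lemma clique_group_normal_form:
  assumes "a \<in> clique_group"
  obtains \<epsilon> where "length \<epsilon> = length vs" "a = cl (clique_word vs \<epsilon>)"
proof -
  have step: "\<exists>\<delta>. length \<delta> = length us \<and> cl [x] \<otimes>\<^bsub>W\<^esub> cl (clique_word us \<epsilon>) = cl (clique_word us \<delta>)"
    if "length \<epsilon> = length us" "set us \<subseteq> set vs" "x \<in> set us" for x \<epsilon> us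
    using that
  proof (induction rule: list_induct2)
    case (Cons e \<epsilon> u us)
    have verts: "x \<in> pverts \<Gamma>" "u \<in> pverts \<Gamma>" "\<And>\<delta>. clique_word us \<delta> \<in> lists (pverts \<Gamma>)"
      using Cons.prems vs_verts clique_word_lists[of us] by auto
    note Cons_eq = racg_elem_Cons[OF verts(2) verts(3)]
    show ?case
    proof (cases "x = u")
      case True
      have "cl [u] \<otimes>\<^bsub>W\<^esub> (cl [u] \<otimes>\<^bsub>W\<^esub> cl (clique_word us \<epsilon>)) = cl (clique_word us \<epsilon>)"
        using verts by (simp add: racg_elem_square flip: W.m_assoc)
      then have "cl [x] \<otimes>\<^bsub>W\<^esub> cl (clique_word (u # us) (e # \<epsilon>)) = cl (clique_word (u # us) ((\<not> e) # \<epsilon>))"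
        using True by (simp add: clique_word_Cons Cons_eq)
      then show ?thesis using Cons.hyps by (intro exI[of _ "(\<not> e) # \<epsilon>"]) simp
    next
      case False
      then obtain \<delta> where \<delta>: "length \<delta> = length us"
        "cl [x] \<otimes>\<^bsub>W\<^esub> cl (clique_word us \<epsilon>) = cl (clique_word us \<delta>)"
        using Cons by auto
      have "cl [x] \<otimes>\<^bsub>W\<^esub> cl [u] = cl [u] \<otimes>\<^bsub>W\<^esub> cl [x]"
        using Cons.prems by (intro clique_gen_commute clique_group_gen) auto
      then have "cl [x] \<otimes>\<^bsub>W\<^esub> (cl [u] \<otimes>\<^bsub>W\<^esub> cl (clique_word us \<epsilon>)) = cl [u] \<otimes>\<^bsub>W\<^esub> cl (clique_word us \<delta>)"
        using verts by (simp flip: W.m_assoc) (simp add: W.m_assoc \<delta>)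
      then have "cl [x] \<otimes>\<^bsub>W\<^esub> cl (clique_word (u # us) (e # \<epsilon>)) = cl (clique_word (u # us) (e # \<delta>))"
        using \<delta> by (simp add: clique_word_Cons Cons_eq)
      then show ?thesis using \<delta> by (intro exI[of _ "e # \<delta>"]) simp
    qed
  qed simp
  have "\<exists>\<epsilon>. length \<epsilon> = length vs \<and> cl g = cl (clique_word vs \<epsilon>)" if "g \<in> lists (set vs)" for g
    using that
  proof induction
    case Nil
    have "clique_word us (map (\<lambda>_. False) us) = []" for us :: "'a list"
      by (induction us) (auto simp: clique_word_def)
    then show ?case by (intro exI[of _ "map (\<lambda>_. False) vs"]) simp
  next
    case (Cons x g)
    then obtain \<epsilon> where \<epsilon>: "length \<epsilon> = length vs" "cl g = cl (clique_word vs \<epsilon>)" by auto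
    have "x \<in> pverts \<Gamma>" "g \<in> lists (pverts \<Gamma>)"
      using Cons vs_verts lists_vs_verts by auto
    then have "cl (x # g) = cl [x] \<otimes>\<^bsub>W\<^esub> cl (clique_word vs \<epsilon>)"
      using racg_elem_Cons[of x \<Gamma> g] \<epsilon> by simp
    then show ?case using step[OF \<epsilon>(1) _ Cons.hyps(1)] by auto
  qed
  then show thesis using assms that by (auto simp: clique_group_def)
qed

lemma finite_clique_group: "finite clique_group"
proof (rule finite_subset)
  show "clique_group \<subseteq> (\<lambda>\<epsilon>. cl (clique_word vs \<epsilon>)) ` {\<epsilon>. set \<epsilon> \<subseteq> UNIV \<and> length \<epsilon> = length vs}"
    by (auto elim: clique_group_normal_form)
  show "finite ((\<lambda>\<epsilon>. cl (clique_word vs \<epsilon>)) ` {\<epsilon>. set \<epsilon> \<subseteq> UNIV \<and> length \<epsilon> = length vs})"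
    by (intro finite_imageI finite_lists_length_eq) simp
qed

section \<open>Conjugation by clique elements and the new graph\<close>

text \<open>Elements of the clique group are their own inverses, so this is conjugation by \<open>a\<close>.\<close>

definition conj_by :: "'a word set \<Rightarrow> 'a word set \<Rightarrow> 'a word set" where
  "conj_by a r = a \<otimes>\<^bsub>W\<^esub> r \<otimes>\<^bsub>W\<^esub> a"

lemma conj_by_carrier [simp]:
  "a \<in> clique_group \<Longrightarrow> r \<in> carrier W \<Longrightarrow> conj_by a r \<in> carrier W"
  by (simp add: conj_by_def)

lemma conj_by_one [simp]: "r \<in> carrier W \<Longrightarrow> conj_by \<one>\<^bsub>W\<^esub> r = r"
  by (simp add: conj_by_def)

lemma conj_by_conj_by:
  assumes "a \<in> clique_group" "b \<in> clique_group" "r \<in> carrier W"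
  shows "conj_by a (conj_by b r) = conj_by (a \<otimes>\<^bsub>W\<^esub> b) r"
proof -
  have "conj_by a (conj_by b r) = (a \<otimes>\<^bsub>W\<^esub> b) \<otimes>\<^bsub>W\<^esub> r \<otimes>\<^bsub>W\<^esub> (b \<otimes>\<^bsub>W\<^esub> a)"
    using assms by (simp add: conj_by_def W.m_assoc)
  then show ?thesis
    by (simp only: conj_by_def clique_group_commute[OF assms(2,1)])
qed

lemma conj_by_mult:
  assumes "a \<in> clique_group" "r \<in> carrier W" "s \<in> carrier W"
  shows "conj_by a r \<otimes>\<^bsub>W\<^esub> conj_by a s = conj_by a (r \<otimes>\<^bsub>W\<^esub> s)"
proof -
  have "conj_by a r \<otimes>\<^bsub>W\<^esub> conj_by a s = a \<otimes>\<^bsub>W\<^esub> r \<otimes>\<^bsub>W\<^esub> (a \<otimes>\<^bsub>W\<^esub> a) \<otimes>\<^bsub>W\<^esub> (s \<otimes>\<^bsub>W\<^esub> a)"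
    using assms by (simp add: conj_by_def W.m_assoc)
  then show ?thesis
    using assms by (simp add: clique_group_square conj_by_def W.m_assoc)
qed

lemma conj_by_adjacent:
  assumes "x \<in> set vs" "(x, u) \<in> parcs \<Gamma>"
  shows "conj_by (cl [x]) (cl [u]) = cl [u]"
proof -
  have "x \<in> pverts \<Gamma>" "u \<in> pverts \<Gamma>"
    using assms arcs_sym arcs_verts by blast+
  then show ?thesis
    using racg_elem_commute[OF assms(2)] by (simp add: conj_by_def W.m_assoc racg_elem_square)
qed

lemma elem_conj:
  assumes "g \<in> lists (set vs)" "u \<in> pverts \<Gamma>"
  shows "cl (g @ [u] @ g) = conj_by (cl g) (cl [u])"
  using assms lists_vs_verts[OF assms(1)] by (simp add: conj_by_def racg_mult)

lemma elem_conj_word: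
  "u \<in> pverts \<Gamma> \<Longrightarrow> cl (conj_word vs \<epsilon> u) = conj_by (cl (clique_word vs \<epsilon>)) (cl [u])"
  unfolding conj_word_def by (rule elem_conj[OF clique_word_lists])

text \<open>A letter of \<open>g\<close> adjacent to \<open>u\<close> commutes with the rest of \<open>g\<close> and with \<open>u\<close>, so its two
  occurrences in \<open>g u g\<close> cancel.\<close>

lemma conj_by_drop_adjacent:
  assumes "g \<in> lists (set vs)" "u \<in> pverts \<Gamma>"
  shows "conj_by (cl (filter (\<lambda>x. (x, u) \<notin> parcs \<Gamma>) g)) (cl [u]) = conj_by (cl g) (cl [u])"
  using assms(1)
proof induction
  case (Cons x g)
  let ?h = "filter (\<lambda>x. (x, u) \<notin> parcs \<Gamma>) g"
  have x: "x \<in> set vs" by fact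
  have lists: "x \<in> pverts \<Gamma>" "g \<in> lists (pverts \<Gamma>)" "?h \<in> lists (pverts \<Gamma>)"
    using Cons.hyps vs_verts by auto
  have cliq: "cl g \<in> clique_group" "cl ?h \<in> clique_group"
    using Cons.hyps by (auto simp: clique_group_def)
  note Cons_eq = racg_elem_Cons[OF lists(1) lists(2)] racg_elem_Cons[OF lists(1) lists(3)]
  show ?case
  proof (cases "(x, u) \<in> parcs \<Gamma>")
    case True
    have "conj_by (cl (x # g)) (cl [u]) = conj_by (cl g \<otimes>\<^bsub>W\<^esub> cl [x]) (cl [u])"
      using Cons_eq clique_gen_commute[OF x cliq(1)] by simp
    also have "\<dots> = conj_by (cl g) (cl [u])"
      using cliq assms x by (simp add: conj_by_adjacent[OF x True] flip: conj_by_conj_by)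
    finally show ?thesis using True Cons.IH by simp
  next
    case False
    have "conj_by (cl (x # ?h)) (cl [u]) = conj_by (cl (x # g)) (cl [u])"
      using cliq assms x Cons.IH by (simp add: Cons_eq flip: conj_by_conj_by)
    then show ?thesis using False by simp
  qed
qed simp

text \<open>The word remaining after the letters adjacent to \<open>u\<close> are dropped satisfies the hypotheses of
  \<open>racg_reduced_conj\<close>.\<close>

lemma reduced_representative:
  assumes u: "u \<in> pverts \<Gamma> - set vs" and len: "length \<epsilon> = length vs"
  obtains \<delta> where "length \<delta> = length vs" "racg_reduced \<Gamma> (conj_word vs \<delta> u)"
    "cl (conj_word vs \<delta> u) = cl (conj_word vs \<epsilon> u)"
proof -
  let ?P = "\<lambda>x. (x, u) \<notin> parcs \<Gamma>"
  define \<delta> where "\<delta> = map2 (\<lambda>e x. e \<and> ?P x) \<epsilon> vs"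
  have word: "clique_word vs \<delta> = filter ?P (clique_word vs \<epsilon>)"
    unfolding \<delta>_def using len
    by (induction \<epsilon> vs rule: list_induct2) (auto simp: clique_word_def)
  have "distinct (clique_word vs \<epsilon>)"
    unfolding clique_word_def
    using vs_distinct len by (intro distinct_map_filter) simp
  then have "racg_reduced \<Gamma> (conj_word vs \<delta> u)"
    unfolding conj_word_def word
    using u vs_verts clique_word_lists[of vs \<epsilon>] arcs_sym
    by (intro racg_reduced_conj) auto
  moreover have "cl (conj_word vs \<delta> u) = cl (conj_word vs \<epsilon> u)"
    using u conj_by_drop_adjacent[OF clique_word_lists] by (simp add: elem_conj_word word)
  moreover have "length \<delta> = length vs" using len by (simp add: \<delta>_def)
  ultimately show thesis using that by blast
qed

text \<open>This description, in which \<open>a\<close> ranges over the whole clique group, makes it visible that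
  conjugation by the clique group permutes the vertices.\<close>

lemma clique_graph_verts_eq:
  "pverts \<Gamma>' = {conj_by a (cl [u]) | a u. a \<in> clique_group \<and> u \<in> pverts \<Gamma> - set vs}" (is "_ = ?R")
proof
  show "pverts \<Gamma>' \<subseteq> ?R"
    using elem_conj_word by (fastforce simp: clique_graph_def clique_graph_verts_def)
  show "?R \<subseteq> pverts \<Gamma>'"
  proof
    fix r assume "r \<in> ?R"
    then obtain a u where a: "a \<in> clique_group" and u: "u \<in> pverts \<Gamma> - set vs"
      and r: "r = conj_by a (cl [u])" by auto
    from a obtain \<epsilon> where \<epsilon>: "length \<epsilon> = length vs" "a = cl (clique_word vs \<epsilon>)"
      by (rule clique_group_normal_form)
    from u \<epsilon>(1) obtain \<delta> where "length \<delta> = length vs" "racg_reduced \<Gamma> (conj_word vs \<delta> u)"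
      "cl (conj_word vs \<delta> u) = cl (conj_word vs \<epsilon> u)"
      by (rule reduced_representative)
    moreover have "r = cl (conj_word vs \<epsilon> u)"
      using u \<epsilon> r by (simp add: elem_conj_word)
    ultimately show "r \<in> pverts \<Gamma>'"
      using u by (auto simp: clique_graph_def clique_graph_verts_def)
  qed
qed

text \<open>The two ends of an arc may need different exponents to become reduced words; the common exponent
  that the construction of \<open>\<Gamma>'\<close> asks for is that of \<open>a\<close>.\<close>

lemma clique_graph_arcs_eq:
  "parcs \<Gamma>' = {(conj_by a (cl [u]), conj_by a (cl [v])) | a u v.
    a \<in> clique_group \<and> u \<in> pverts \<Gamma> - set vs \<and> v \<in> pverts \<Gamma> - set vs \<and> (u, v) \<in> parcs \<Gamma>}"
  (is "_ = ?R")
proof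
  show "parcs \<Gamma>' \<subseteq> ?R"
  proof
    fix p assume "p \<in> parcs \<Gamma>'"
    then obtain u v \<epsilon> where "u \<in> pverts \<Gamma> - set vs" "v \<in> pverts \<Gamma> - set vs" "(u, v) \<in> parcs \<Gamma>"
      "p = (cl (conj_word vs \<epsilon> u), cl (conj_word vs \<epsilon> v))"
      by (auto simp: clique_graph_def clique_graph_arcs_def)
    moreover from this have "p = (conj_by (cl (clique_word vs \<epsilon>)) (cl [u]),
        conj_by (cl (clique_word vs \<epsilon>)) (cl [v]))"
      by (simp add: elem_conj_word)
    ultimately show "p \<in> ?R"
      using clique_word_clique_group by blast
  qed
  show "?R \<subseteq> parcs \<Gamma>'"
  proof
    fix p assume "p \<in> ?R"
    then obtain a u v where a: "a \<in> clique_group"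
      and u: "u \<in> pverts \<Gamma> - set vs" and v: "v \<in> pverts \<Gamma> - set vs" and uv: "(u, v) \<in> parcs \<Gamma>"
      and p: "p = (conj_by a (cl [u]), conj_by a (cl [v]))" by auto
    from a obtain \<epsilon> where \<epsilon>: "length \<epsilon> = length vs" "a = cl (clique_word vs \<epsilon>)"
      by (rule clique_group_normal_form)
    obtain \<delta>1 where \<delta>1: "length \<delta>1 = length vs" "racg_reduced \<Gamma> (conj_word vs \<delta>1 u)"
      "cl (conj_word vs \<delta>1 u) = cl (conj_word vs \<epsilon> u)"
      using u \<epsilon>(1) by (rule reduced_representative)
    obtain \<delta>2 where \<delta>2: "length \<delta>2 = length vs" "racg_reduced \<Gamma> (conj_word vs \<delta>2 v)"
      "cl (conj_word vs \<delta>2 v) = cl (conj_word vs \<epsilon> v)"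
      using v \<epsilon>(1) by (rule reduced_representative)
    have "p = (cl (conj_word vs \<delta>1 u), cl (conj_word vs \<delta>2 v))"
      using u v p \<epsilon> \<delta>1 \<delta>2 by (simp add: elem_conj_word)
    then have "p \<in> clique_graph_arcs \<Gamma> vs"
      unfolding clique_graph_arcs_def mem_Collect_eq using u v uv \<epsilon>(1) \<delta>1 \<delta>2
      by (intro exI[of _ u] exI[of _ \<delta>1] exI[of _ v] exI[of _ \<delta>2] conjI exI[of _ \<epsilon>])
    then show "p \<in> parcs \<Gamma>'"
      by (simp add: clique_graph_def)
  qed
qed

lemma new_vert_carrier: "r \<in> pverts \<Gamma>' \<Longrightarrow> r \<in> carrier W"
  by (auto simp: clique_graph_verts_eq)

lemma gen_new_vert: "u \<in> pverts \<Gamma> - set vs \<Longrightarrow> cl [u] \<in> pverts \<Gamma>'"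
  unfolding clique_graph_verts_eq using conj_by_one[of "cl [u]"] clique_group_one by fastforce

lemma new_vert_square:
  assumes "r \<in> pverts \<Gamma>'"
  shows "r \<otimes>\<^bsub>W\<^esub> r = \<one>\<^bsub>W\<^esub>"
proof -
  from assms obtain a u where "a \<in> clique_group" "u \<in> pverts \<Gamma>" "r = conj_by a (cl [u])"
    by (auto simp: clique_graph_verts_eq)
  then show ?thesis
    by (simp add: conj_by_mult racg_elem_square) (simp add: conj_by_def clique_group_square)
qed

lemma new_arc_commute:
  assumes "(r, s) \<in> parcs \<Gamma>'"
  shows "r \<otimes>\<^bsub>W\<^esub> s = s \<otimes>\<^bsub>W\<^esub> r"
proof -
  from assms obtain a u v where "a \<in> clique_group" "u \<in> pverts \<Gamma>" "v \<in> pverts \<Gamma>"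
    "(u, v) \<in> parcs \<Gamma>" "r = conj_by a (cl [u])" "s = conj_by a (cl [v])"
    by (auto simp: clique_graph_arcs_eq)
  then show ?thesis
    using racg_elem_commute[of u v \<Gamma>] by (simp add: conj_by_mult)
qed

lemma conj_by_new_vert:
  assumes "a \<in> clique_group" "r \<in> pverts \<Gamma>'"
  shows "conj_by a r \<in> pverts \<Gamma>'"
proof -
  from assms obtain b u where "b \<in> clique_group" "u \<in> pverts \<Gamma> - set vs" "r = conj_by b (cl [u])"
    by (auto simp: clique_graph_verts_eq)
  moreover from this have "conj_by a r = conj_by (a \<otimes>\<^bsub>W\<^esub> b) (cl [u])"
    using assms by (simp add: conj_by_conj_by)
  ultimately show ?thesis
    using assms(1) clique_group_mult unfolding clique_graph_verts_eq by blast
qed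

lemma conj_by_new_arc:
  assumes "a \<in> clique_group" "(r, s) \<in> parcs \<Gamma>'"
  shows "(conj_by a r, conj_by a s) \<in> parcs \<Gamma>'"
proof -
  from assms obtain b u v where "b \<in> clique_group" "u \<in> pverts \<Gamma> - set vs"
    "v \<in> pverts \<Gamma> - set vs" "(u, v) \<in> parcs \<Gamma>" "r = conj_by b (cl [u])" "s = conj_by b (cl [v])"
    by (auto simp: clique_graph_arcs_eq)
  moreover from this have "conj_by a r = conj_by (a \<otimes>\<^bsub>W\<^esub> b) (cl [u])"
    "conj_by a s = conj_by (a \<otimes>\<^bsub>W\<^esub> b) (cl [v])"
    using assms by (simp_all add: conj_by_conj_by)
  ultimately show ?thesis
    using assms(1) clique_group_mult unfolding clique_graph_arcs_eq by blast
qed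

section \<open>The new group as a subgroup of finite index\<close>

text \<open>The endomorphism of \<open>W'\<close> induced by the graph automorphism \<open>conj_by a\<close> of \<open>\<Gamma>'\<close>.\<close>

definition conj_aut :: "'a word set \<Rightarrow> 'a word set word set \<Rightarrow> 'a word set word set" where
  "conj_aut a = racg_lift \<Gamma>' W' (\<lambda>r. cl' [conj_by a r])"

lemma
  assumes a: "a \<in> clique_group"
  shows conj_aut_hom: "conj_aut a \<in> hom W' W'"
    and conj_aut_gen: "\<And>r. r \<in> pverts \<Gamma>' \<Longrightarrow> conj_aut a (cl' [r]) = cl' [conj_by a r]"
proof -
  have comm: "cl' [conj_by a r] \<otimes>\<^bsub>W'\<^esub> cl' [conj_by a s] = cl' [conj_by a s] \<otimes>\<^bsub>W'\<^esub> cl' [conj_by a r]"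
    if "(r, s) \<in> parcs \<Gamma>'" "r \<in> pverts \<Gamma>'" "s \<in> pverts \<Gamma>'" for r s
    by (intro racg_elem_commute conj_by_new_arc conj_by_new_vert a that)
  show "conj_aut a \<in> hom W' W'"
    unfolding conj_aut_def
    by (intro racg_lift_hom group_racg comm) (simp_all add: a conj_by_new_vert racg_elem_square)
  show "conj_aut a (cl' [r]) = cl' [conj_by a r]" if "r \<in> pverts \<Gamma>'" for r
    unfolding conj_aut_def
    by (intro racg_lift_gen group_racg comm)
      (simp_all add: a that conj_by_new_vert racg_elem_square)
qed

lemma conj_aut_closed [simp]: "a \<in> clique_group \<Longrightarrow> n \<in> carrier W' \<Longrightarrow> conj_aut a n \<in> carrier W'"
  by (rule hom_in_carrier[OF conj_aut_hom])

lemma conj_aut_one_arg [simp]: "a \<in> clique_group \<Longrightarrow> conj_aut a \<one>\<^bsub>W'\<^esub> = \<one>\<^bsub>W'\<^esub>"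
  using conj_aut_hom hom_one W'.is_group by blast

lemma conj_aut_mult_arg:
  "a \<in> clique_group \<Longrightarrow> n \<in> carrier W' \<Longrightarrow> m \<in> carrier W' \<Longrightarrow>
    conj_aut a (n \<otimes>\<^bsub>W'\<^esub> m) = conj_aut a n \<otimes>\<^bsub>W'\<^esub> conj_aut a m"
  by (rule hom_mult[OF conj_aut_hom])

lemma new_gen_carrier [simp]: "r \<in> pverts \<Gamma>' \<Longrightarrow> cl' [r] \<in> carrier W'"
  by simp

lemma conj_aut_mult:
  assumes "n \<in> carrier W'" "a \<in> clique_group" "b \<in> clique_group"
  shows "conj_aut a (conj_aut b n) = conj_aut (a \<otimes>\<^bsub>W\<^esub> b) n"
  using assms(1)
  by (induction rule: racg_induct)
    (use assms in \<open>simp_all add: conj_aut_mult_arg conj_aut_gen conj_by_new_vert conj_by_conj_by new_vert_carrier\<close>)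

lemma conj_aut_one: "n \<in> carrier W' \<Longrightarrow> conj_aut \<one>\<^bsub>W\<^esub> n = n"
  by (induction rule: racg_induct) (simp_all add: conj_aut_mult_arg conj_aut_gen new_vert_carrier)

text \<open>If \<open>W\<close> is the semidirect product of \<open>W'\<close> and the clique group, then \<open>W'\<close> represents the left
  cosets of the clique group, and this is left multiplication on them: for a clique element \<open>x\<close>,
  the coset of \<open>x n\<close> is the coset of \<open>x n x\<close>.\<close>

definition act :: "'a \<Rightarrow> 'a word set word set \<Rightarrow> 'a word set word set" where
  "act x = (if x \<in> set vs then conj_aut (cl [x]) else (\<otimes>\<^bsub>W'\<^esub>) (cl' [cl [x]]))"

lemma act_closed: "x \<in> pverts \<Gamma> \<Longrightarrow> n \<in> carrier W' \<Longrightarrow> act x n \<in> carrier W'"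
  by (simp add: act_def gen_new_vert)

lemma act_invol:
  assumes "x \<in> pverts \<Gamma>" "n \<in> carrier W'"
  shows "act x (act x n) = n"
proof (cases "x \<in> set vs")
  case True
  then show ?thesis using assms by (simp add: act_def conj_aut_mult racg_elem_square conj_aut_one)
next
  case False
  then have "cl [x] \<in> pverts \<Gamma>'" using assms by (simp add: gen_new_vert)
  then show ?thesis
    using False assms by (simp add: act_def racg_elem_square flip: W'.m_assoc)
qed

lemma act_commute_clique:
  assumes "x \<in> set vs" "(x, y) \<in> parcs \<Gamma>" "y \<in> pverts \<Gamma>" "n \<in> carrier W'"
  shows "act x (act y n) = act y (act x n)"
proof (cases "y \<in> set vs")
  case True
  then show ?thesis
    using assms by (simp add: act_def conj_aut_mult clique_group_commute)
next
  case False
  then have "cl [y] \<in> pverts \<Gamma>'" using assms by (simp add: gen_new_vert)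
  then show ?thesis
    using False assms by (simp add: act_def conj_aut_mult_arg conj_aut_gen conj_by_adjacent)
qed

lemma act_commute:
  assumes "(x, y) \<in> parcs \<Gamma>" "x \<in> pverts \<Gamma>" "y \<in> pverts \<Gamma>" "n \<in> carrier W'"
  shows "act x (act y n) = act y (act x n)"
proof (cases "x \<in> set vs \<or> y \<in> set vs")
  case True
  then show ?thesis using assms act_commute_clique arcs_sym by metis
next
  case False
  then have xy: "x \<in> pverts \<Gamma> - set vs" "y \<in> pverts \<Gamma> - set vs" using assms by auto
  then have "(conj_by \<one>\<^bsub>W\<^esub> (cl [x]), conj_by \<one>\<^bsub>W\<^esub> (cl [y])) \<in> parcs \<Gamma>'"
    using assms(1) clique_group_one unfolding clique_graph_arcs_eq by blast
  then have "(cl [x], cl [y]) \<in> parcs \<Gamma>'"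
    using assms by simp
  then have "cl' [cl [x]] \<otimes>\<^bsub>W'\<^esub> cl' [cl [y]] = cl' [cl [y]] \<otimes>\<^bsub>W'\<^esub> cl' [cl [x]]"
    using xy by (intro racg_elem_commute gen_new_vert)
  then show ?thesis
    using False assms xy by (simp add: act_def gen_new_vert flip: W'.m_assoc)
qed

lemma act_clique_word:
  assumes "n \<in> carrier W'" "g \<in> lists (set vs)"
  shows "foldr act g n = conj_aut (cl g) n"
  using assms(2)
proof induction
  case Nil
  then show ?case using assms by (simp add: conj_aut_one flip: racg_one)
next
  case (Cons x g)
  have "cl g \<in> clique_group" using Cons by (auto simp: clique_group_def)
  moreover have "cl (x # g) = cl [x] \<otimes>\<^bsub>W\<^esub> cl g"
    using Cons vs_verts lists_vs_verts[of g] by (intro racg_elem_Cons) auto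
  ultimately show ?case
    using assms Cons by (simp add: act_def conj_aut_mult)
qed

text \<open>A vertex of \<open>\<Gamma>'\<close> is itself an element of \<open>W\<close>.\<close>

definition embed :: "'a word set word set \<Rightarrow> 'a word set" where
  "embed = racg_lift \<Gamma>' W (\<lambda>r. r)"

lemma embed_hom: "embed \<in> hom W' W"
  unfolding embed_def
  by (intro racg_lift_hom group_racg new_vert_carrier new_vert_square new_arc_commute)

lemma embed_gen: "r \<in> pverts \<Gamma>' \<Longrightarrow> embed (cl' [r]) = r"
  unfolding embed_def
  by (intro racg_lift_gen group_racg new_vert_carrier new_vert_square new_arc_commute)

text \<open>The vertex \<open>g u g\<close> acts as left multiplication by \<open>u\<close> conjugated by the automorphism
  \<open>conj_aut g\<close>. That is left multiplication by the image of \<open>u\<close> under this automorphism, which is the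
  vertex \<open>g u g\<close>.\<close>

lemma embed_acts_by_left_mult:
  assumes "n \<in> carrier W'"
  shows "\<exists>w\<in>lists (pverts \<Gamma>). cl w = embed n \<and> (\<forall>p\<in>carrier W'. foldr act w p = n \<otimes>\<^bsub>W'\<^esub> p)"
  using assms
proof (induction rule: racg_induct)
  case one
  have "embed \<one>\<^bsub>W'\<^esub> = \<one>\<^bsub>W\<^esub>"
    using embed_hom hom_one W.is_group W'.is_group by blast
  then show ?case by (intro bexI[of _ "[]"]) (simp_all add: racg_one)
next
  case (gen r m)
  from gen.IH obtain w where w: "w \<in> lists (pverts \<Gamma>)" "cl w = embed m"
    "\<forall>p\<in>carrier W'. foldr act w p = m \<otimes>\<^bsub>W'\<^esub> p" by blast
  from gen.hyps obtain g u where g: "g \<in> lists (set vs)" and u: "u \<in> pverts \<Gamma> - set vs"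
    and r: "r = conj_by (cl g) (cl [u])"
    by (auto simp: clique_graph_verts_eq clique_group_def)
  have cg: "cl g \<in> clique_group" using g by (auto simp: clique_group_def)
  have word: "g @ [u] @ g \<in> lists (pverts \<Gamma>)" using lists_vs_verts[OF g] u by auto
  have elem: "cl (g @ [u] @ g) = r" using elem_conj[OF g] u r by simp
  have act_r: "foldr act (g @ [u] @ g) q = cl' [r] \<otimes>\<^bsub>W'\<^esub> q" if q: "q \<in> carrier W'" for q
  proof -
    have "cl [u] \<in> pverts \<Gamma>'" using u by (rule gen_new_vert)
    then have "foldr act (g @ [u] @ g) q = conj_aut (cl g) (cl' [cl [u]] \<otimes>\<^bsub>W'\<^esub> conj_aut (cl g) q)"
      using q u g cg by (simp add: act_clique_word) (simp add: act_def act_clique_word)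
    then show ?thesis
      using q cg r \<open>cl [u] \<in> pverts \<Gamma>'\<close>
      by (simp add: conj_aut_mult_arg conj_aut_gen conj_aut_mult clique_group_square conj_aut_one)
  qed
  show ?case
  proof (intro bexI[of _ "(g @ [u] @ g) @ w"] conjI ballI)
    show "(g @ [u] @ g) @ w \<in> lists (pverts \<Gamma>)" using word w by simp
    show "cl ((g @ [u] @ g) @ w) = embed (cl' [r] \<otimes>\<^bsub>W'\<^esub> m)"
      using gen.hyps hom_mult[OF embed_hom, of "cl' [r]" m] racg_mult[OF word w(1)] elem w(2)
      by (simp add: embed_gen)
    show "foldr act ((g @ [u] @ g) @ w) p = cl' [r] \<otimes>\<^bsub>W'\<^esub> m \<otimes>\<^bsub>W'\<^esub> p"
      if "p \<in> carrier W'" for p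
      using that gen.hyps act_r[of "m \<otimes>\<^bsub>W'\<^esub> p"] w(3) by (simp add: W'.m_assoc)
  qed
qed

text \<open>The action recovers \<open>n\<close> from \<open>embed n\<close>, by applying it to the unit element.\<close>

lemma embed_inj: "inj_on embed (carrier W')"
proof (rule inj_onI)
  fix n m assume n: "n \<in> carrier W'" and m: "m \<in> carrier W'" and eq: "embed n = embed m"
  obtain v where v: "v \<in> lists (pverts \<Gamma>)" "cl v = embed n"
    "\<forall>p\<in>carrier W'. foldr act v p = n \<otimes>\<^bsub>W'\<^esub> p"
    using embed_acts_by_left_mult[OF n] by blast
  obtain w where w: "w \<in> lists (pverts \<Gamma>)" "cl w = embed m"
    "\<forall>p\<in>carrier W'. foldr act w p = m \<otimes>\<^bsub>W'\<^esub> p"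
    using embed_acts_by_left_mult[OF m] by blast
  have "foldr act v \<one>\<^bsub>W'\<^esub> = foldr act w \<one>\<^bsub>W'\<^esub>"
  proof (rule racg_action_well_defined[where X = "carrier W'"])
    show "cl v = cl w" using v w eq by simp
  qed (fact act_closed act_invol act_commute v(1) w(1) W'.one_closed)+
  then show "n = m" using v(3) w(3) n m by simp
qed

lemma embed_image_subgroup: "subgroup (embed ` carrier W') W"
proof -
  interpret group_hom W' W embed
    by (simp add: group_hom_def group_hom_axioms_def embed_hom W.is_group W'.is_group)
  show ?thesis by (rule img_is_subgroup)
qed

text \<open>Induction on appending a letter to the word: if \<open>w = h a\<close>, a clique letter is absorbed into
  \<open>a\<close>, and any other letter \<open>x\<close> gives \<open>h a x = h (a x a) a\<close>.\<close>

lemma embed_image_factor: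
  assumes "w \<in> lists (pverts \<Gamma>)"
  shows "\<exists>h\<in>embed ` carrier W'. \<exists>a\<in>clique_group. cl w = h \<otimes>\<^bsub>W\<^esub> a"
  using assms
proof (induction w rule: rev_induct)
  case Nil
  have "\<one>\<^bsub>W\<^esub> \<in> embed ` carrier W'" by (rule subgroup.one_closed[OF embed_image_subgroup])
  then show ?case by (intro bexI[of _ "\<one>\<^bsub>W\<^esub>"]) (auto simp flip: racg_one)
next
  case (snoc x w)
  then obtain h a where h: "h \<in> embed ` carrier W'" and a: "a \<in> clique_group"
    and w: "cl w = h \<otimes>\<^bsub>W\<^esub> a" by auto
  have hW: "h \<in> carrier W" using h subgroup.subset[OF embed_image_subgroup] by auto
  have x: "x \<in> pverts \<Gamma>" using snoc by simp
  have wx: "cl (w @ [x]) = h \<otimes>\<^bsub>W\<^esub> (a \<otimes>\<^bsub>W\<^esub> cl [x])"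
    using snoc.prems racg_mult[of w \<Gamma> "[x]"] w hW a x by (simp add: W.m_assoc)
  show ?case
  proof (cases "x \<in> set vs")
    case True
    then show ?thesis using wx h a by (meson clique_group_gen clique_group_mult)
  next
    case False
    then have "conj_by a (cl [x]) \<in> pverts \<Gamma>'"
      using a x conj_by_new_vert gen_new_vert by auto
    then have "conj_by a (cl [x]) \<in> embed ` carrier W'"
      using embed_gen new_gen_carrier by (metis imageI)
    then have "h \<otimes>\<^bsub>W\<^esub> conj_by a (cl [x]) \<in> embed ` carrier W'"
      using h subgroup.m_closed[OF embed_image_subgroup] by blast
    moreover have "cl (w @ [x]) = h \<otimes>\<^bsub>W\<^esub> conj_by a (cl [x]) \<otimes>\<^bsub>W\<^esub> a"
      using wx hW a x by (simp add: conj_by_def W.m_assoc clique_group_square)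
    ultimately show ?thesis using a by blast
  qed
qed

lemma embed_image_finite_index: "finite_index_subgroup (embed ` carrier W') W"
proof -
  let ?H = "embed ` carrier W'"
  have "rcosets\<^bsub>W\<^esub> ?H \<subseteq> (\<lambda>a. ?H #>\<^bsub>W\<^esub> a) ` clique_group"
  proof
    fix C assume "C \<in> rcosets\<^bsub>W\<^esub> ?H"
    then obtain n where n: "n \<in> carrier W" "C = ?H #>\<^bsub>W\<^esub> n"
      by (auto simp: RCOSETS_def)
    from n(1) obtain w where w: "w \<in> lists (pverts \<Gamma>)" "n = cl w"
      unfolding racg_carrier by (rule imageE)
    obtain h a where h: "h \<in> ?H" and a: "a \<in> clique_group" and "n = h \<otimes>\<^bsub>W\<^esub> a"
      using embed_image_factor[OF w(1)] w(2) by metis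
    moreover have "?H \<subseteq> carrier W" by (rule subgroup.subset[OF embed_image_subgroup])
    moreover from this h have "?H #>\<^bsub>W\<^esub> h = ?H"
      by (intro W.coset_join2 embed_image_subgroup) auto
    ultimately have "C = ?H #>\<^bsub>W\<^esub> a"
      using n W.coset_mult_assoc[of ?H h a] by auto
    then show "C \<in> (\<lambda>a. ?H #>\<^bsub>W\<^esub> a) ` clique_group" using a by blast
  qed
  then show ?thesis
    unfolding finite_index_subgroup_def
    using embed_image_subgroup finite_clique_group finite_surj by blast
qed

lemma racg_commensurable_clique_graph: "commensurable W W'"
  unfolding commensurable_def
proof (intro exI conjI)
  show "finite_index_subgroup (embed ` carrier W') W" by (rule embed_image_finite_index)
  have "rcosets\<^bsub>W'\<^esub> (carrier W') \<subseteq> {carrier W'}"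
    using W'.coset_join2[OF _ W'.subgroup_self] by (auto simp: RCOSETS_def)
  then show "finite_index_subgroup (carrier W') W'"
    unfolding finite_index_subgroup_def using W'.subgroup_self finite_subset by blast
  have "embed \<in> iso (W'\<lparr>carrier := carrier W'\<rparr>) (W\<lparr>carrier := embed ` carrier W'\<rparr>)"
    using embed_hom embed_inj by (auto simp: iso_def hom_def bij_betw_def)
  then have "W'\<lparr>carrier := carrier W'\<rparr> \<cong> W\<lparr>carrier := embed ` carrier W'\<rparr>"
    by (auto simp: is_iso_def)
  then show "W\<lparr>carrier := embed ` carrier W'\<rparr> \<cong> W'\<lparr>carrier := carrier W'\<rparr>"
    using W'.subgroup_imp_group[OF W'.subgroup_self] by (rule group.iso_sym[rotated])
qed

end

theorem proposition5p2:
  fixes \<Gamma> K :: "'a pair_pre_digraph" and vs :: "'a list"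
  assumes "pair_graph \<Gamma>"
    and "proper_clique K \<Gamma>"
    and "distinct vs" and "set vs = pverts K"
  shows "commensurable (racg \<Gamma>) (racg (clique_graph \<Gamma> vs))"
proof -
  interpret pair_graph \<Gamma> by fact
  have sub: "pverts K \<subseteq> pverts \<Gamma>" "parcs K \<subseteq> parcs \<Gamma>"
    using assms(2) by (auto simp: proper_clique_def subgraph_def)
  have "(x, y) \<in> parcs K" if "x \<in> pverts K" "y \<in> pverts K" "x \<noteq> y" for x y
    using assms(2) that by (auto simp: proper_clique_def complete_digraph_pair_def)
  then have "clique_in_graph \<Gamma> vs"
    using sub assms(3,4) arcs_symmetric in_arcsD1 by unfold_locales auto
  then show ?thesis by (rule clique_in_graph.racg_commensurable_clique_graph)
qed

end
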